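(* Suppose that the trust-region subproblem $\min_{\|x\|\le\Delta}\{\frac12 x^TAx+x^Tg\}$ is in easy case and $\lambda_*>0$. There exists a scalar $\underline\varrho>0$ such that if $0<|\varepsilon|<\underline\varrho$, then (i) $\|x_*(\varepsilon)\|=\|x_*\|=\Delta$ and $\lim_{\varepsilon\to0}x_*(\varepsilon)=x_*$; (ii) $x_*(\varepsilon)$ is differentiable at $\varepsilon=0$, and $$x_*'(0)=\frac{\mathrm dx_*(\varepsilon)}{\mathrm d\varepsilon}\bigg|_{\varepsilon=0}=\left(-A_*^{-1}+\frac{y_2y_2^T}{y_1^Ty_2}\right)(Ex_*+e),\qquad\text{where } A_*=A+\lambda_*I.$$
   Context: $\|\cdot\|$ is the Euclidean norm. $A\in\mathbb R^{n\times n}$ is symmetric, $0\ne g\in\mathbb R^n$, $\Delta>0$; $E\in\mathbb R^{n\times n}$ is symmetric, $e\in\mathbb R^n$, $\varepsilon\in\mathbb R$; $A(\varepsilon)=A+\varepsilon E$, $g(\varepsilon)=g+\varepsilon e$. Trust-region subproblem (TRS): for symmetric $B\in\mathbb R^{n\times n}$ and $b\in\mathbb R^n$, consider $\min_{\|x\|\le\Delta}\{\frac12x^TBx+x^Tb\}$. A vector $x_*$ with $\|x_*\|\le\Delta$ is a global minimizer iff there is a Lagrange multiplier $\lambda_*\ge0$ with $(B+\lambda_*I)x_*=-b$, $\lambda_*(\Delta-\|x_*\|)=0$ and $B+\lambda_*I$ positive semidefinite. The TRS is in easy case if $B+\lambda_*I$ is positive definite (equivalently $\lambda_*$ exceeds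 minus the smallest eigenvalue of $B$); then the minimizer is unique. $(\lambda_*,x_* )$ denotes the multiplier and solution for $(B,b)=(A,g)$, and $(\lambda_*(\varepsilon),x_*(\varepsilon))$ those for $(B,b)=(A(\varepsilon),g(\varepsilon))$ (the perturbed TRS), so $\lambda_*(0)=\lambda_*$, $x_*(0)=x_*$. Standing assumption: the $\varepsilon$ considered are such that the perturbed TRS is also in easy case. Let $$M=\begin{pmatrix}-A&\frac{gg^T}{\Delta^2}\\ I&-A\end{pmatrix}\in\mathbb R^{2n\times2n}.$$ When $\|x_*\|=\Delta$, $\lambda_*$ is an eigenvalue of $M$; $y=(y_1^T,y_2^T)^T$ with $y_1,y_2\in\mathbb R^n$ is a unit-length real right eigenvector of $M$ for the eigenvalue $\lambda_*$. *)

theory Defs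
  imports "HOL-Analysis.Analysis"
begin

definition symmetric_mat :: "real ^ 'n ^ 'n \<Rightarrow> bool" where
  "symmetric_mat B \<longleftrightarrow> transpose B = B"

definition pos_semidefinite :: "real ^ 'n ^ 'n \<Rightarrow> bool" where
  "pos_semidefinite B \<longleftrightarrow> symmetric_mat B \<and> (\<forall>v. 0 \<le> v \<bullet> (B *v v))"

definition pos_definite :: "real ^ 'n ^ 'n \<Rightarrow> bool" where
  "pos_definite B \<longleftrightarrow> symmetric_mat B \<and> (\<forall>v. v \<noteq> 0 \<longrightarrow> 0 < v \<bullet> (B *v v))"

definition trs_objective :: "real ^ 'n ^ 'n \<Rightarrow> real ^ 'n \<Rightarrow> real ^ 'n \<Rightarrow> real" where
  "trs_objective B b x = 1 / 2 * (x \<bullet> (B *v x)) + x \<bullet> b"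

definition trs_minimizer :: "real ^ 'n ^ 'n \<Rightarrow> real ^ 'n \<Rightarrow> real \<Rightarrow> real ^ 'n \<Rightarrow> bool" where
  "trs_minimizer B b \<Delta> x \<longleftrightarrow> is_arg_min (trs_objective B b) (\<lambda>z. norm z \<le> \<Delta>) x"

definition trs_multiplier ::
  "real ^ 'n ^ 'n \<Rightarrow> real ^ 'n \<Rightarrow> real \<Rightarrow> real ^ 'n \<Rightarrow> real \<Rightarrow> bool" where
  "trs_multiplier B b \<Delta> x \<mu> \<longleftrightarrow>
     0 \<le> \<mu> \<and> (B + \<mu> *\<^sub>R mat 1) *v x = - b \<and> \<mu> * (\<Delta> - norm x) = 0 \<and>
     pos_semidefinite (B + \<mu> *\<^sub>R mat 1)"

definition trs_solution ::
  "real ^ 'n ^ 'n \<Rightarrow> real ^ 'n \<Rightarrow> real \<Rightarrow> real \<Rightarrow> real ^ 'n \<Rightarrow> bool" where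
  "trs_solution B b \<Delta> \<mu> x \<longleftrightarrow> trs_minimizer B b \<Delta> x \<and> trs_multiplier B b \<Delta> x \<mu>"

(* For \<Delta> > 0 and symmetric B, the pair (\<mu>, x) below is unique when it exists. *)
definition trs_easy_case :: "real ^ 'n ^ 'n \<Rightarrow> real ^ 'n \<Rightarrow> real \<Rightarrow> bool" where
  "trs_easy_case B b \<Delta> \<longleftrightarrow>
     (\<exists>\<mu> x. trs_solution B b \<Delta> \<mu> x \<and> pos_definite (B + \<mu> *\<^sub>R mat 1))"

definition outer :: "real ^ 'n \<Rightarrow> real ^ 'm \<Rightarrow> real ^ 'm ^ 'n" where
  "outer u v = (\<chi> i j. u $ i * v $ j)"

(* Block objects are indexed by the sum type: Inl is the first block, Inr the second. *)
definition block_vec :: "real ^ 'n \<Rightarrow> real ^ 'm \<Rightarrow> real ^ ('n + 'm)" where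
  "block_vec u v = (\<chi> i. case i of Inl k \<Rightarrow> u $ k | Inr k \<Rightarrow> v $ k)"

definition block_mat ::
  "real ^ 'n ^ 'n \<Rightarrow> real ^ 'm ^ 'n \<Rightarrow> real ^ 'n ^ 'm \<Rightarrow> real ^ 'm ^ 'm
     \<Rightarrow> real ^ ('n + 'm) ^ ('n + 'm)" where
  "block_mat P Q R S =
     (\<chi> i. case i of Inl k \<Rightarrow> block_vec (P $ k) (Q $ k) | Inr k \<Rightarrow> block_vec (R $ k) (S $ k))"

definition trs_matrix :: "real ^ 'n ^ 'n \<Rightarrow> real ^ 'n \<Rightarrow> real \<Rightarrow> real ^ ('n + 'n) ^ ('n + 'n)" where
  "trs_matrix A g \<Delta> = block_mat (- A) ((1 / \<Delta>\<^sup>2) *\<^sub>R outer g g) (mat 1) (- A)"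

definition right_eigenvector :: "real ^ 'k ^ 'k \<Rightarrow> real \<Rightarrow> real ^ 'k \<Rightarrow> bool" where
  "right_eigenvector C \<mu> v \<longleftrightarrow> v \<noteq> 0 \<and> C *v v = \<mu> *\<^sub>R v"

end

theory Submission
  imports Defs
begin

text \<open>
  For small \<open>\<epsilon>\<close> the secular equation has a root near \<open>lam 0\<close>, where the shifted matrix is still
  positive definite; by uniqueness of trust-region solutions in easy case this root is
  \<open>lam \<epsilon>\<close>. Hence \<open>lam\<close> and then \<open>x\<close> are continuous at 0, and the constraint is active.
  Write \<open>S\<close> for the inverse of \<open>A + lam 0 I\<close>, \<open>h = x \<epsilon> - x 0\<close> and
  \<open>p = x \<epsilon> + x 0\<close>. Since both solutions have norm \<open>\<Delta>\<close>, \<open>p\<close> is orthogonal to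
  \<open>h = - \<epsilon> S (E x \<epsilon> + e) - (lam \<epsilon> - lam 0) S x \<epsilon>\<close>. This determines
  \<open>lam \<epsilon> - lam 0\<close> and expresses \<open>h / \<epsilon>\<close> as a continuous function of \<open>x \<epsilon>\<close>, so continuity
  of \<open>x\<close> alone gives the derivative. Finally the eigenvector satisfies \<open>y1 = k x 0\<close> and
  \<open>y2 = k S x 0\<close> with \<open>k \<noteq> 0\<close>.
\<close>

section \<open>Definite forms and linear systems with shifted matrices\<close>

lemma scaleR_matrix_vector [simp]:
  fixes A :: "real ^ 'n ^ 'm"
  shows "(c *\<^sub>R A) *v v = c *\<^sub>R (A *v v)"
  by (rule scaleR_matrix_vector_assoc[symmetric])

lemma shift_matrix_vector:
  fixes A E :: "real ^ 'n ^ 'n"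
  shows "(A + \<epsilon> *\<^sub>R E + \<mu> *\<^sub>R mat 1) *v v = A *v v + \<epsilon> *\<^sub>R (E *v v) + \<mu> *\<^sub>R v"
  by (simp add: matrix_vector_mult_add_rdistrib)

lemma shift_matrix_vector':
  fixes A :: "real ^ 'n ^ 'n"
  shows "(A + \<mu> *\<^sub>R mat 1) *v v = A *v v + \<mu> *\<^sub>R v"
  by (simp add: matrix_vector_mult_add_rdistrib)

lemma symmetric_mat_shift:
  fixes A E :: "real ^ 'n ^ 'n"
  assumes "symmetric_mat A" "symmetric_mat E"
  shows "symmetric_mat (A + \<epsilon> *\<^sub>R E + \<mu> *\<^sub>R mat 1)"
  using assms unfolding symmetric_mat_def transpose_def mat_def
  by (auto simp: vec_eq_iff)

lemma symmetric_mat_inner: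
  fixes B :: "real ^ 'n ^ 'n"
  assumes "symmetric_mat B"
  shows "u \<bullet> (B *v v) = (B *v u) \<bullet> v"
  using assms unfolding symmetric_mat_def
  by (metis dot_lmul_matrix transpose_matrix_vector)

text \<open>The quadratic form attains a minimum on the compact unit sphere, which is positive by
  definiteness; homogeneity carries this bound to all vectors.\<close>

lemma pos_definite_coercive:
  fixes B :: "real ^ 'n ^ 'n"
  assumes "pos_definite B"
  obtains c where "c > 0" "\<And>v. c * (v \<bullet> v) \<le> v \<bullet> (B *v v)"
proof -
  let ?S = "sphere 0 1 :: (real ^ 'n) set"
  have "continuous_on ?S (\<lambda>v. v \<bullet> (B *v v))"
    by (intro continuous_intros linear_continuous_on matrix_vector_mul_bounded_linear)
  moreover have "?S \<noteq> {}" by simp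
  ultimately have "\<exists>w\<in>?S. \<forall>v\<in>?S. w \<bullet> (B *v w) \<le> v \<bullet> (B *v v)"
    by (intro continuous_attains_inf compact_sphere)
  then obtain w where w: "w \<in> ?S" "\<And>v. v \<in> ?S \<Longrightarrow> w \<bullet> (B *v w) \<le> v \<bullet> (B *v v)"
    by blast
  show thesis
  proof
    have "w \<noteq> 0" using w(1) by auto
    then show "w \<bullet> (B *v w) > 0"
      using assms by (simp add: pos_definite_def)
    fix v
    show "w \<bullet> (B *v w) * (v \<bullet> v) \<le> v \<bullet> (B *v v)"
    proof (cases "v = 0")
      case False
      let ?u = "(1 / norm v) *\<^sub>R v"
      have "w \<bullet> (B *v w) \<le> ?u \<bullet> (B *v ?u)"
        using False by (intro w(2)) simp
      also have "\<dots> = (v \<bullet> (B *v v)) / (v \<bullet> v)"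
        by (simp add: matrix_vector_mult_scaleR power2_norm_eq_inner[symmetric] power2_eq_square)
      finally show ?thesis
        using False by (simp add: field_simps)
    qed simp
  qed
qed

lemma quadratic_form_bound:
  fixes E :: "real ^ 'n ^ 'n"
  obtains K where "K > 0" "\<And>v. \<bar>v \<bullet> (E *v v)\<bar> \<le> K * (v \<bullet> v)"
proof -
  obtain K where K: "K > 0" "\<And>v. norm (E *v v) \<le> norm v * K"
    using bounded_linear.pos_bounded[OF matrix_vector_mul_bounded_linear[of E]] by blast
  have "\<bar>v \<bullet> (E *v v)\<bar> \<le> K * (v \<bullet> v)" for v
  proof -
    have "\<bar>v \<bullet> (E *v v)\<bar> \<le> norm v * norm (E *v v)" by (rule Cauchy_Schwarz_ineq2)
    also have "\<dots> \<le> norm v * (norm v * K)" by (intro mult_left_mono K) simp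
    finally show ?thesis by (simp add: dot_square_norm power2_eq_square mult_ac)
  qed
  with K(1) show thesis by (rule that)
qed

text \<open>Cauchy-Schwarz turns coercivity into a bound \<open>1 / c\<close> for the inverse,
  without mentioning the inverse.\<close>

lemma coercive_norm_bound:
  fixes B :: "real ^ 'n ^ 'n"
  assumes "\<And>v. c * (v \<bullet> v) \<le> v \<bullet> (B *v v)"
  shows "c * norm v \<le> norm (B *v v)"
proof (cases "v = 0")
  case False
  have "c * norm v * norm v \<le> v \<bullet> (B *v v)"
    using assms[of v] by (simp add: dot_square_norm power2_eq_square mult_ac)
  also have "\<dots> \<le> norm (B *v v) * norm v"
    using norm_cauchy_schwarz[of v "B *v v"] by (simp add: mult.commute)
  finally show ?thesis using False by simp
qed simp

lemma pos_definite_invertible: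
  fixes B :: "real ^ 'n ^ 'n"
  assumes "pos_definite B"
  shows "invertible B"
  using assms unfolding invertible_left_inverse matrix_left_invertible_ker pos_definite_def
  by (metis inner_zero_right less_irrefl)

lemma matrix_inv_cancel:
  fixes B :: "real ^ 'n ^ 'n"
  assumes "invertible B"
  shows "B *v (matrix_inv B *v v) = v" "matrix_inv B *v (B *v v) = v"
proof -
  have "B ** matrix_inv B = mat 1 \<and> matrix_inv B ** B = mat 1"
    using assms unfolding invertible_def matrix_inv_def by (rule someI_ex)
  then show "B *v (matrix_inv B *v v) = v" "matrix_inv B *v (B *v v) = v"
    by (simp_all add: matrix_vector_mul_assoc)
qed

text \<open>The matrix \<open>B t\<close> maps the error \<open>z t - z0\<close> to the residual
  \<open>b t - B t *v z0\<close>, so a uniform coercivity constant bounds the error by the residual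
  over \<open>c\<close>. This replaces continuity of matrix inversion, and it serves both for a
  varying \<epsilon> and for a varying shift.\<close>

lemma coercive_solution_tendsto:
  fixes B :: "'a \<Rightarrow> real ^ 'n ^ 'n"
  assumes "c > 0"
    and "\<forall>\<^sub>F t in F. \<forall>v. c * (v \<bullet> v) \<le> v \<bullet> (B t *v v)"
    and "\<forall>\<^sub>F t in F. B t *v z t = b t"
    and "((\<lambda>t. b t - B t *v z0) \<longlongrightarrow> 0) F"
  shows "(z \<longlongrightarrow> z0) F"
proof -
  have "\<forall>\<^sub>F t in F. norm (z t - z0) \<le> norm (b t - B t *v z0) / c"
    using assms(2,3)
  proof eventually_elim
    case (elim t)
    then show ?case
      using coercive_norm_bound[of c "B t" "z t - z0"] \<open>c > 0\<close>
      by (simp add: matrix_vector_mult_diff_distrib field_simps)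
  qed
  moreover have "((\<lambda>t. norm (b t - B t *v z0) / c) \<longlongrightarrow> 0) F"
    using tendsto_divide[OF tendsto_norm_zero[OF assms(4)] tendsto_const[of c]] \<open>c > 0\<close> by simp
  ultimately have "((\<lambda>t. z t - z0) \<longlongrightarrow> 0) F"
    by (rule Lim_null_comparison)
  then show ?thesis by (simp add: LIM_zero_iff)
qed

text \<open>Strict monotonicity of the secular function. Subtracting the systems gives
  \<open>B *v (u - z) = s *\<^sub>R z\<close>, so definiteness makes the inner product of
  \<open>u - z\<close> and \<open>z\<close> positive, and expanding the square of
  \<open>u = z + (u - z)\<close> finishes.\<close>

lemma norm_shifted_solution_less:
  fixes B :: "real ^ 'n ^ 'n"
  assumes "pos_definite B" "s > 0" "B *v u = b" "B *v z + s *\<^sub>R z = b" "b \<noteq> 0"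
  shows "norm z < norm u"
proof -
  have "z \<noteq> 0" using assms by auto
  have Bd: "B *v (u - z) = s *\<^sub>R z"
    using assms by (simp add: matrix_vector_mult_diff_distrib algebra_simps)
  then have "u - z \<noteq> 0" using \<open>z \<noteq> 0\<close> \<open>s > 0\<close> by auto
  then have "0 < (u - z) \<bullet> (s *\<^sub>R z)"
    using assms(1) Bd unfolding pos_definite_def by metis
  then have "0 < (u - z) \<bullet> z" using \<open>s > 0\<close> by (simp add: zero_less_mult_iff)
  moreover have "u \<bullet> u = z \<bullet> z + 2 * ((u - z) \<bullet> z) + (u - z) \<bullet> (u - z)"
    by (simp add: inner_diff inner_commute)
  moreover have "0 \<le> (u - z) \<bullet> (u - z)" by simp
  ultimately have "z \<bullet> z < u \<bullet> u" by linarith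
  then show ?thesis by (simp add: norm_lt)
qed

section \<open>Optimality and uniqueness for the trust-region subproblem\<close>

lemma trs_objective_gap:
  fixes B :: "real ^ 'n ^ 'n"
  assumes "symmetric_mat B" "B *v u + \<mu> *\<^sub>R u = - b"
  shows "trs_objective B b z - trs_objective B b u =
    1 / 2 * ((z - u) \<bullet> (B *v (z - u) + \<mu> *\<^sub>R (z - u))) + \<mu> / 2 * (u \<bullet> u - z \<bullet> z)"
proof -
  \<comment> \<open>Stationarity eliminates \<open>b\<close>. The gap is then an exact second-order
    expansion around \<open>u\<close>, in which the shift by \<mu> is compensated by a difference of
    squared norms.\<close>
  have b: "b = - (B *v u) - \<mu> *\<^sub>R u"
    using assms(2) by (metis add.commute diff_minus_eq_add minus_add_distrib minus_minus uminus_add_conv_diff)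
  have "u \<bullet> (B *v z) = z \<bullet> (B *v u)"
    using symmetric_mat_inner[OF assms(1)] by (simp add: inner_commute)
  then show ?thesis
    unfolding trs_objective_def b
    by (simp add: matrix_vector_mult_diff_distrib inner_diff inner_add inner_commute[of u z]
      field_simps)
qed

text \<open>By complementarity either \<mu> vanishes or \<open>u\<close> lies on the boundary and
  \<open>z\<close> is no longer than \<open>u\<close>; in both cases the norm term of the exact gap
  is nonnegative.\<close>

lemma trs_objective_gap_ge:
  fixes B :: "real ^ 'n ^ 'n"
  assumes "symmetric_mat B" "0 \<le> \<mu>" "B *v u + \<mu> *\<^sub>R u = - b" "\<mu> * (\<Delta> - norm u) = 0"
    and "norm z \<le> \<Delta>"
  shows "1 / 2 * ((z - u) \<bullet> ((B + \<mu> *\<^sub>R mat 1) *v (z - u)))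
    \<le> trs_objective B b z - trs_objective B b u"
proof -
  have "0 \<le> \<mu> / 2 * (u \<bullet> u - z \<bullet> z)"
  proof (cases "\<mu> = 0")
    case False
    then have "norm z \<le> norm u" using assms by simp
    then show ?thesis using \<open>0 \<le> \<mu>\<close> by (simp add: norm_le)
  qed simp
  then show ?thesis
    unfolding trs_objective_gap[OF assms(1,3)] shift_matrix_vector' by linarith
qed

lemma pos_definite_imp_semidefinite: "pos_definite B \<Longrightarrow> pos_semidefinite B"
  unfolding pos_definite_def pos_semidefinite_def
  by (metis inner_zero_left less_eq_real_def)

lemma trs_solutionI:
  fixes B :: "real ^ 'n ^ 'n"
  assumes "symmetric_mat B" "0 \<le> \<mu>" "(B + \<mu> *\<^sub>R mat 1) *v u = - b" "norm u = \<Delta>"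
    and "pos_definite (B + \<mu> *\<^sub>R mat 1)"
  shows "trs_solution B b \<Delta> \<mu> u"
proof -
  have psd: "pos_semidefinite (B + \<mu> *\<^sub>R mat 1)"
    using assms(5) by (rule pos_definite_imp_semidefinite)
  have "trs_objective B b u \<le> trs_objective B b z" if "norm z \<le> \<Delta>" for z
  proof -
    have "0 \<le> (z - u) \<bullet> ((B + \<mu> *\<^sub>R mat 1) *v (z - u))"
      using psd unfolding pos_semidefinite_def by blast
    with trs_objective_gap_ge[OF assms(1,2), of u b \<Delta> z] show ?thesis
      using assms(3,4) that by (simp add: shift_matrix_vector')
  qed
  then show ?thesis
    using assms psd
    by (auto simp: trs_solution_def trs_minimizer_def trs_multiplier_def is_arg_min_linorder)
qed

text \<open>Since \<open>u'\<close> is also a minimizer, the gap bound makes the shifted form at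
  \<open>u' - u\<close> nonpositive, and definiteness forces \<open>u' = u\<close>. Comparing the
  stationarity equations at the nonzero \<open>u\<close> identifies the multipliers. Definiteness is
  asked of the first pair only, so a pair constructed by hand can be matched with any given
  solution.\<close>

lemma trs_solution_unique:
  fixes B :: "real ^ 'n ^ 'n"
  assumes "symmetric_mat B" "trs_solution B b \<Delta> \<mu> u" "pos_definite (B + \<mu> *\<^sub>R mat 1)"
    and "trs_solution B b \<Delta> \<mu>' u'" "u \<noteq> 0"
  shows "u' = u" "\<mu>' = \<mu>"
proof -
  have u: "0 \<le> \<mu>" "B *v u + \<mu> *\<^sub>R u = - b" "\<mu> * (\<Delta> - norm u) = 0" "norm u \<le> \<Delta>"
    and u': "B *v u' + \<mu>' *\<^sub>R u' = - b" "norm u' \<le> \<Delta>"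
      "trs_objective B b u' \<le> trs_objective B b u"
    using assms(2,4)
    by (auto simp: trs_solution_def trs_minimizer_def trs_multiplier_def is_arg_min_linorder
      shift_matrix_vector')
  have "(u' - u) \<bullet> ((B + \<mu> *\<^sub>R mat 1) *v (u' - u)) \<le> 0"
    using trs_objective_gap_ge[OF assms(1) u(1-3) u'(2)] u'(3) by simp
  then show eq: "u' = u"
    using assms(3) unfolding pos_definite_def by (metis eq_iff_diff_eq_0 not_le)
  have "\<mu>' *\<^sub>R u = \<mu> *\<^sub>R u"
    using u(2) u'(1) eq by (metis add_left_cancel)
  then show "\<mu>' = \<mu>" using \<open>u \<noteq> 0\<close> by simp
qed

section \<open>Roots of the perturbed secular equation\<close>

lemma shifted_coercive:
  fixes A E :: "real ^ 'n ^ 'n"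
  assumes "\<And>v. c * (v \<bullet> v) \<le> v \<bullet> ((A + \<mu>0 *\<^sub>R mat 1) *v v)"
    and "\<And>v. \<bar>v \<bullet> (E *v v)\<bar> \<le> K * (v \<bullet> v)"
    and "\<bar>\<mu> - \<mu>0\<bar> \<le> c / 4" "\<bar>\<epsilon>\<bar> * K \<le> c / 4"
  shows "c / 2 * (v \<bullet> v) \<le> v \<bullet> ((A + \<epsilon> *\<^sub>R E + \<mu> *\<^sub>R mat 1) *v v)"
proof -
  have "\<bar>\<epsilon> * (v \<bullet> (E *v v))\<bar> \<le> \<bar>\<epsilon>\<bar> * (K * (v \<bullet> v))"
    by (simp add: abs_mult mult_left_mono assms(2))
  also have "\<dots> \<le> c / 4 * (v \<bullet> v)"
    using mult_right_mono[OF assms(4), of "v \<bullet> v"] by (simp add: mult_ac)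
  finally have 1: "\<bar>\<epsilon> * (v \<bullet> (E *v v))\<bar> \<le> c / 4 * (v \<bullet> v)" .
  have "\<bar>(\<mu> - \<mu>0) * (v \<bullet> v)\<bar> \<le> c / 4 * (v \<bullet> v)"
    using mult_right_mono[OF assms(3), of "v \<bullet> v"] by (simp add: abs_mult)
  \<comment> \<open>The changes in matrix and shift each cost at most \<open>c / 4\<close>, which
    leaves \<open>c / 2\<close> of the original constant.\<close>
  moreover have "v \<bullet> ((A + \<epsilon> *\<^sub>R E + \<mu> *\<^sub>R mat 1) *v v) = v \<bullet> ((A + \<mu>0 *\<^sub>R mat 1) *v v)
    + \<epsilon> * (v \<bullet> (E *v v)) + (\<mu> - \<mu>0) * (v \<bullet> v)"
    by (simp add: shift_matrix_vector shift_matrix_vector' inner_add algebra_simps)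
  ultimately show ?thesis using 1 assms(1)[of v] by linarith
qed

lemma coercive_pos_definite:
  fixes B :: "real ^ 'n ^ 'n"
  assumes "symmetric_mat B" "c > 0" "\<And>v. c * (v \<bullet> v) \<le> v \<bullet> (B *v v)"
  shows "pos_definite B"
  unfolding pos_definite_def
proof (intro conjI allI impI)
  fix v :: "real ^ 'n"
  assume "v \<noteq> 0"
  then have "0 < c * (v \<bullet> v)" using assms(2) by simp
  also have "\<dots> \<le> v \<bullet> (B *v v)" by (rule assms(3))
  finally show "0 < v \<bullet> (B *v v)" .
qed (fact assms(1))

text \<open>The norm of the solution of the shifted system is strictly decreasing in the shift when
  \<open>\<epsilon> = 0\<close>, so for small \<open>\<epsilon>\<close> it still crosses the level \<open>norm u\<close> within distance
  \<open>\<eta>\<close> of \<open>\<mu>0\<close>, by the intermediate value theorem.\<close>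

lemma perturbed_multiplier_exists:
  fixes A E :: "real ^ 'n ^ 'n"
  assumes sym: "symmetric_mat A" "symmetric_mat E"
    and pd: "pos_definite (A + \<mu>0 *\<^sub>R mat 1)"
    and eq: "(A + \<mu>0 *\<^sub>R mat 1) *v u = - g" and "g \<noteq> 0" and "\<eta> > 0"
  shows "\<forall>\<^sub>F \<epsilon> in at 0. \<exists>\<mu> z. \<bar>\<mu> - \<mu>0\<bar> < \<eta> \<and> pos_definite (A + \<epsilon> *\<^sub>R E + \<mu> *\<^sub>R mat 1) \<and>
    (A + \<epsilon> *\<^sub>R E + \<mu> *\<^sub>R mat 1) *v z = - (g + \<epsilon> *\<^sub>R e) \<and> norm z = norm u"
proof -
  obtain c where c: "c > 0" "\<And>v. c * (v \<bullet> v) \<le> v \<bullet> ((A + \<mu>0 *\<^sub>R mat 1) *v v)"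
    using pos_definite_coercive[OF pd] by metis
  obtain K where K: "K > 0" "\<And>v. \<bar>v \<bullet> (E *v v)\<bar> \<le> K * (v \<bullet> v)"
    using quadratic_form_bound[of E] by metis
  \<comment> \<open>The bound \<open>c / 4\<close> keeps all shifts within \<delta> of
    \<open>\<mu>0\<close> coercive, and \<open>\<eta> / 2\<close> makes the final distance strictly
    less than \<eta>.\<close>
  define \<delta> where "\<delta> = min (c / 4) (\<eta> / 2)"
  have \<delta>: "\<delta> > 0" "\<delta> \<le> c / 4" "\<delta> < \<eta>"
    using c(1) \<open>\<eta> > 0\<close> by (auto simp: \<delta>_def)
  let ?B = "\<lambda>\<mu> \<epsilon>. A + \<epsilon> *\<^sub>R E + \<mu> *\<^sub>R mat 1"
  define z where "z = (\<lambda>\<mu> \<epsilon>. matrix_inv (?B \<mu> \<epsilon>) *v - (g + \<epsilon> *\<^sub>R e))"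
  have coer: "c / 2 * (v \<bullet> v) \<le> v \<bullet> (?B \<mu> \<epsilon> *v v)"
    if "\<bar>\<mu> - \<mu>0\<bar> \<le> \<delta>" "\<bar>\<epsilon>\<bar> * K \<le> c / 4" for \<mu> \<epsilon> v
    using that \<delta>(2) by (intro shifted_coercive[OF c(2) K(2)]) auto
  have pdB: "pos_definite (?B \<mu> \<epsilon>)" if "\<bar>\<mu> - \<mu>0\<bar> \<le> \<delta>" "\<bar>\<epsilon>\<bar> * K \<le> c / 4" for \<mu> \<epsilon>
    using coercive_pos_definite[OF symmetric_mat_shift[OF sym] _ coer[OF that]] c(1) by simp
  have z: "?B \<mu> \<epsilon> *v z \<mu> \<epsilon> = - (g + \<epsilon> *\<^sub>R e)"
    if "\<bar>\<mu> - \<mu>0\<bar> \<le> \<delta>" "\<bar>\<epsilon>\<bar> * K \<le> c / 4" for \<mu> \<epsilon>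
    unfolding z_def using pos_definite_invertible[OF pdB[OF that]] by (rule matrix_inv_cancel)
  have "((\<lambda>\<epsilon>. \<bar>\<epsilon>\<bar> * K) \<longlongrightarrow> \<bar>0\<bar> * K) (at (0::real))"
    by (intro tendsto_intros)
  then have small: "\<forall>\<^sub>F \<epsilon> in at (0::real). \<bar>\<epsilon>\<bar> * K < c / 4"
    by (rule order_tendstoD(2)) (use c(1) in simp)
  \<comment> \<open>For a fixed shift the solution is continuous in \<epsilon> at 0. This transfers
    the strict inequalities at the two endpoints \<open>\<mu>0 + \<delta>\<close> and
    \<open>\<mu>0 - \<delta>\<close> to small \<epsilon>.\<close>
  have lim: "((\<lambda>\<epsilon>. z \<mu> \<epsilon>) \<longlongrightarrow> z \<mu> 0) (at 0)" if "\<bar>\<mu> - \<mu>0\<bar> \<le> \<delta>" for \<mu>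
  proof (rule coercive_solution_tendsto)
    show "c / 2 > 0" using c(1) by simp
    show "\<forall>\<^sub>F \<epsilon> in at 0. \<forall>v. c / 2 * (v \<bullet> v) \<le> v \<bullet> (?B \<mu> \<epsilon> *v v)"
      using small by eventually_elim (use coer that in auto)
    show "\<forall>\<^sub>F \<epsilon> in at 0. ?B \<mu> \<epsilon> *v z \<mu> \<epsilon> = - (g + \<epsilon> *\<^sub>R e)"
      using small by eventually_elim (use z that in auto)
    have "((\<lambda>\<epsilon>. - (g + \<epsilon> *\<^sub>R e) - (A *v z \<mu> 0 + \<epsilon> *\<^sub>R (E *v z \<mu> 0) + \<mu> *\<^sub>R z \<mu> 0))
      \<longlongrightarrow> - (g + 0 *\<^sub>R e) - (A *v z \<mu> 0 + 0 *\<^sub>R (E *v z \<mu> 0) + \<mu> *\<^sub>R z \<mu> 0)) (at 0)"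
      by (intro tendsto_intros)
    also have "- (g + 0 *\<^sub>R e) - (A *v z \<mu> 0 + 0 *\<^sub>R (E *v z \<mu> 0) + \<mu> *\<^sub>R z \<mu> 0) = 0"
      using z[OF that, of 0] c(1) by (simp add: shift_matrix_vector')
    finally show "((\<lambda>\<epsilon>. - (g + \<epsilon> *\<^sub>R e) - ?B \<mu> \<epsilon> *v z \<mu> 0) \<longlongrightarrow> 0) (at 0)"
      by (simp only: shift_matrix_vector)
  qed
  have z0: "A *v z \<mu> 0 + \<mu> *\<^sub>R z \<mu> 0 = - g" if "\<bar>\<mu> - \<mu>0\<bar> \<le> \<delta>" for \<mu>
    using z[OF that, of 0] c(1) by (simp add: shift_matrix_vector')
  have u0: "A *v u + \<mu>0 *\<^sub>R u = - g" using eq by (simp add: shift_matrix_vector')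
  have right: "norm (z (\<mu>0 + \<delta>) 0) < norm u"
  proof (rule norm_shifted_solution_less[OF pd \<delta>(1) eq])
    show "(A + \<mu>0 *\<^sub>R mat 1) *v z (\<mu>0 + \<delta>) 0 + \<delta> *\<^sub>R z (\<mu>0 + \<delta>) 0 = - g"
      using z0[of "\<mu>0 + \<delta>"] \<delta>(1) by (simp add: shift_matrix_vector' algebra_simps)
  qed (use \<open>g \<noteq> 0\<close> in simp)
  \<comment> \<open>Here the roles are exchanged: the base matrix has shift
    \<open>\<mu>0 - \<delta>\<close>, still definite by the choice of \<delta>, and \<open>u\<close>
    solves the system shifted further by \<delta>.\<close>
  have left: "norm u < norm (z (\<mu>0 - \<delta>) 0)"
  proof (rule norm_shifted_solution_less[of "?B (\<mu>0 - \<delta>) 0" \<delta> _ "- g"])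
    show "pos_definite (?B (\<mu>0 - \<delta>) 0)" using pdB[of "\<mu>0 - \<delta>" 0] \<delta>(1) c(1) by simp
    show "?B (\<mu>0 - \<delta>) 0 *v z (\<mu>0 - \<delta>) 0 = - g"
      using z[of "\<mu>0 - \<delta>" 0] \<delta>(1) c(1) by simp
    show "?B (\<mu>0 - \<delta>) 0 *v u + \<delta> *\<^sub>R u = - g"
      using u0 by (simp add: shift_matrix_vector' algebra_simps)
  qed (use \<open>g \<noteq> 0\<close> \<delta>(1) in simp_all)
  have "\<forall>\<^sub>F \<epsilon> in at 0. norm (z (\<mu>0 + \<delta>) \<epsilon>) < norm u"
    using \<delta>(1) by (intro order_tendstoD(2)[OF tendsto_norm[OF lim] right]) simp
  moreover have "\<forall>\<^sub>F \<epsilon> in at 0. norm u < norm (z (\<mu>0 - \<delta>) \<epsilon>)"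
    using \<delta>(1) by (intro order_tendstoD(1)[OF tendsto_norm[OF lim] left]) simp
  ultimately show ?thesis
    using small
  proof eventually_elim
    case (elim \<epsilon>)
    have dist: "\<bar>\<mu> - \<mu>0\<bar> \<le> \<delta>" if "\<mu> \<in> {\<mu>0 - \<delta>..\<mu>0 + \<delta>}" for \<mu>
      using that by auto
    \<comment> \<open>The residual argument again, now with \<epsilon> fixed and the shift as
      parameter. The estimates hold on the whole interval, so \<open>UNIV\<close> serves as the
      neighbourhood.\<close>
    have "continuous_on {\<mu>0 - \<delta>..\<mu>0 + \<delta>} (\<lambda>\<mu>. z \<mu> \<epsilon>)"
      unfolding continuous_on_def
    proof
      fix \<mu>
      assume \<mu>: "\<mu> \<in> {\<mu>0 - \<delta>..\<mu>0 + \<delta>}"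
      let ?F = "at \<mu> within {\<mu>0 - \<delta>..\<mu>0 + \<delta>}"
      show "((\<lambda>\<mu>. z \<mu> \<epsilon>) \<longlongrightarrow> z \<mu> \<epsilon>) ?F"
      proof (rule coercive_solution_tendsto)
        show "c / 2 > 0" using c(1) by simp
        show "\<forall>\<^sub>F \<mu> in ?F. \<forall>v. c / 2 * (v \<bullet> v) \<le> v \<bullet> (?B \<mu> \<epsilon> *v v)"
          by (intro eventually_at_topological[THEN iffD2] exI[of _ UNIV])
            (use coer dist elim in auto)
        show "\<forall>\<^sub>F \<mu> in ?F. ?B \<mu> \<epsilon> *v z \<mu> \<epsilon> = - (g + \<epsilon> *\<^sub>R e)"
          by (intro eventually_at_topological[THEN iffD2] exI[of _ UNIV])
            (use z dist elim in auto)
        have "((\<lambda>\<nu>. - (g + \<epsilon> *\<^sub>R e) - (A *v z \<mu> \<epsilon> + \<epsilon> *\<^sub>R (E *v z \<mu> \<epsilon>) + \<nu> *\<^sub>R z \<mu> \<epsilon>))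
          \<longlongrightarrow> - (g + \<epsilon> *\<^sub>R e) - (A *v z \<mu> \<epsilon> + \<epsilon> *\<^sub>R (E *v z \<mu> \<epsilon>) + \<mu> *\<^sub>R z \<mu> \<epsilon>)) ?F"
          by (intro tendsto_intros)
        also have "- (g + \<epsilon> *\<^sub>R e) - (A *v z \<mu> \<epsilon> + \<epsilon> *\<^sub>R (E *v z \<mu> \<epsilon>) + \<mu> *\<^sub>R z \<mu> \<epsilon>) = 0"
          using z[OF dist[OF \<mu>], of \<epsilon>] elim by (simp add: shift_matrix_vector)
        finally show "((\<lambda>\<nu>. - (g + \<epsilon> *\<^sub>R e) - ?B \<nu> \<epsilon> *v z \<mu> \<epsilon>) \<longlongrightarrow> 0) ?F"
          by (simp only: shift_matrix_vector)
      qed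
    qed
    then have "continuous_on {\<mu>0 - \<delta>..\<mu>0 + \<delta>} (\<lambda>\<mu>. norm (z \<mu> \<epsilon>))"
      by (rule continuous_on_norm)
    then obtain \<mu> where \<mu>: "\<mu> \<in> {\<mu>0 - \<delta>..\<mu>0 + \<delta>}" "norm (z \<mu> \<epsilon>) = norm u"
      using IVT2'[of "\<lambda>\<mu>. norm (z \<mu> \<epsilon>)" "\<mu>0 + \<delta>" "norm u" "\<mu>0 - \<delta>"] elim \<delta>(1) by auto
    have "\<bar>\<mu> - \<mu>0\<bar> < \<eta>" using dist[OF \<mu>(1)] \<delta>(3) by simp
    moreover have "\<bar>\<epsilon>\<bar> * K \<le> c / 4" using elim by simp
    ultimately show ?case
      using pdB[OF dist[OF \<mu>(1)]] z[OF dist[OF \<mu>(1)]] \<mu>(2) by blast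
  qed
qed

section \<open>Block matrices and the eigenvector\<close>

lemma outer_mult_vec: "outer u v *v w = (v \<bullet> w) *\<^sub>R u"
  by (simp add: vec_eq_iff outer_def matrix_vector_mult_def inner_vec_def sum_distrib_left
    sum_distrib_right mult_ac)

lemma block_mat_mult_vec:
  fixes u :: "real ^ 'a" and v :: "real ^ 'b"
  shows "block_mat P Q R S *v block_vec u v = block_vec (P *v u + Q *v v) (R *v u + S *v v)"
proof -
  have "sum f UNIV = (\<Sum>i\<in>UNIV. f (Inl i)) + (\<Sum>j\<in>UNIV. f (Inr j))" for f :: "'a + 'b \<Rightarrow> real"
    using sum.Plus[of UNIV UNIV f] by simp
  then show ?thesis
    by (simp add: vec_eq_iff block_mat_def block_vec_def matrix_vector_mult_def split: sum.split)
qed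

lemma block_vec_eq_iff: "block_vec u v = block_vec u' v' \<longleftrightarrow> u = u' \<and> v = v'"
  by (auto simp: vec_eq_iff block_vec_def split: sum.splits)

lemma block_vec_scaleR: "c *\<^sub>R block_vec u v = block_vec (c *\<^sub>R u) (c *\<^sub>R v)"
  by (simp add: vec_eq_iff block_vec_def split: sum.split)

lemma block_vec_zero: "block_vec 0 0 = 0"
  by (simp add: vec_eq_iff block_vec_def split: sum.split)

text \<open>With \<open>B = A + \<mu> *\<^sub>R mat 1\<close>, the block rows say that
  \<open>B *v y2 = y1\<close> and that \<open>B *v y1\<close> is a multiple of \<open>g\<close>,
  hence of \<open>B *v u\<close>. Inverting \<open>B\<close> twice gives both blocks.\<close>

lemma trs_matrix_eigenvector:
  fixes A :: "real ^ 'n ^ 'n"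
  assumes ev: "right_eigenvector (trs_matrix A g \<Delta>) \<mu> (block_vec y1 y2)"
    and inv: "invertible (A + \<mu> *\<^sub>R mat 1)"
    and u: "(A + \<mu> *\<^sub>R mat 1) *v u = - g"
  obtains k where "k \<noteq> 0" "y1 = k *\<^sub>R u" "y2 = k *\<^sub>R (matrix_inv (A + \<mu> *\<^sub>R mat 1) *v u)"
proof -
  let ?B = "A + \<mu> *\<^sub>R mat 1"
  have "- A *v y1 + ((1 / \<Delta>\<^sup>2) *\<^sub>R outer g g) *v y2 = \<mu> *\<^sub>R y1"
    and "y1 + - A *v y2 = \<mu> *\<^sub>R y2" and ne: "block_vec y1 y2 \<noteq> 0"
    using ev by (auto simp: right_eigenvector_def trs_matrix_def block_mat_mult_vec
      block_vec_scaleR block_vec_eq_iff)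
  moreover have neg: "- A *v v = - (A *v v)" for v
    by (simp add: vec_eq_iff matrix_vector_mult_def sum_negf)
  moreover have "((1 / \<Delta>\<^sup>2) *\<^sub>R outer g g) *v y2 = ((g \<bullet> y2) / \<Delta>\<^sup>2) *\<^sub>R g"
    by (simp add: outer_mult_vec)
  ultimately have "((g \<bullet> y2) / \<Delta>\<^sup>2) *\<^sub>R g = A *v y1 + \<mu> *\<^sub>R y1" "y1 = A *v y2 + \<mu> *\<^sub>R y2"
    by (metis add.commute add_diff_cancel_left' diff_add_cancel uminus_add_conv_diff)+
  then have By1: "?B *v y1 = ((g \<bullet> y2) / \<Delta>\<^sup>2) *\<^sub>R g" and By2: "?B *v y2 = y1"
    by (simp_all only: shift_matrix_vector')
  \<comment> \<open>The sign comes from \<open>B *v u = - g\<close>. If \<open>k\<close> were 0,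
    both blocks would vanish, contrary to the eigenvector being nonzero.\<close>
  define k where "k = - (g \<bullet> y2) / \<Delta>\<^sup>2"
  have "?B *v y1 = ?B *v (k *\<^sub>R u)"
    unfolding By1 matrix_vector_mult_scaleR u k_def by simp
  then have y1: "y1 = k *\<^sub>R u"
    using matrix_inv_cancel(2)[OF inv] by metis
  have y2: "y2 = k *\<^sub>R (matrix_inv ?B *v u)"
    using matrix_inv_cancel(2)[OF inv, of y2] By2 y1 by (simp add: matrix_vector_mult_scaleR)
  have "k \<noteq> 0" using ne y1 y2 block_vec_zero by auto
  then show thesis using y1 y2 that by blast
qed

section \<open>Difference quotients and the derivative of the solution\<close>

lemma has_vector_derivative_difference_quotientI:
  fixes f :: "real \<Rightarrow> 'a :: real_normed_vector"
  assumes "((\<lambda>s. (1 / (s - t)) *\<^sub>R (f s - f t)) \<longlongrightarrow> D) (at t)"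
  shows "(f has_vector_derivative D) (at t)"
proof -
  have "\<forall>\<^sub>F s in at t. norm ((1 / (s - t)) *\<^sub>R (f s - f t) - D)
      = norm (f s - f t - (s - t) *\<^sub>R D) / norm (s - t)"
    using eventually_neq_at_within[of t t UNIV]
  proof eventually_elim
    case (elim s)
    then have "(1 / (s - t)) *\<^sub>R (f s - f t) - D = (1 / (s - t)) *\<^sub>R (f s - f t - (s - t) *\<^sub>R D)"
      by (simp add: scaleR_diff_right)
    then show ?case by simp
  qed
  then have "((\<lambda>s. norm (f s - f t - (s - t) *\<^sub>R D) / norm (s - t)) \<longlongrightarrow> 0) (at t)"
    using tendsto_norm_zero[OF LIM_zero[OF assms]] by (rule Lim_transform_eventually[rotated])
  then show ?thesis
    by (simp add: has_vector_derivative_def has_derivative_iff_norm bounded_linear_scaleR_left)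
qed

theorem theorem3p7:
  fixes A E :: "real ^ 'n ^ 'n" and g e :: "real ^ 'n" and \<Delta> :: real
    and lam :: "real \<Rightarrow> real" and x :: "real \<Rightarrow> real ^ 'n"
    and y1 y2 :: "real ^ 'n"
  assumes "symmetric_mat A" and "g \<noteq> 0" and "0 < \<Delta>" and "symmetric_mat E"
    and easy: "trs_easy_case A g \<Delta>"
    and sol: "\<And>\<epsilon>. trs_easy_case (A + \<epsilon> *\<^sub>R E) (g + \<epsilon> *\<^sub>R e) \<Delta> \<Longrightarrow>
                trs_solution (A + \<epsilon> *\<^sub>R E) (g + \<epsilon> *\<^sub>R e) \<Delta> (lam \<epsilon>) (x \<epsilon>)"
    and "0 < lam 0"
    and "right_eigenvector (trs_matrix A g \<Delta>) (lam 0) (block_vec y1 y2)"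
    and "norm (block_vec y1 y2) = 1"
  shows "\<exists>\<rho>>0. \<forall>\<epsilon>. 0 < \<bar>\<epsilon>\<bar> \<and> \<bar>\<epsilon>\<bar> < \<rho> \<longrightarrow>
           (norm (x \<epsilon>) = norm (x 0) \<and> norm (x 0) = \<Delta> \<and> (x \<longlongrightarrow> x 0) (at 0)) \<and>
           (x has_vector_derivative
              (- matrix_inv (A + lam 0 *\<^sub>R mat 1) + (1 / (y1 \<bullet> y2)) *\<^sub>R outer y2 y2)
                *v (E *v x 0 + e)) (at 0)"
proof -
  let ?B = "A + lam 0 *\<^sub>R mat 1"
  define S where "S = matrix_inv ?B"
  have sol0: "trs_solution A g \<Delta> (lam 0) (x 0)"
    using sol[of 0] easy by simp
  then have eq0: "?B *v x 0 = - g" and norm0: "norm (x 0) = \<Delta>"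
    using \<open>0 < lam 0\<close> by (auto simp: trs_solution_def trs_multiplier_def)
  have x0: "x 0 \<noteq> 0" using norm0 \<open>0 < \<Delta>\<close> by auto
  \<comment> \<open>Easy case supplies some pair with a definite shifted matrix; uniqueness
    identifies its multiplier with \<open>lam 0\<close>.\<close>
  have pd: "pos_definite ?B"
  proof -
    obtain \<mu> u where \<mu>: "trs_solution A g \<Delta> \<mu> u" "pos_definite (A + \<mu> *\<^sub>R mat 1)"
      using easy unfolding trs_easy_case_def by blast
    have "u \<noteq> 0"
      using \<mu>(1) \<open>g \<noteq> 0\<close> by (auto simp: trs_solution_def trs_multiplier_def)
    then show ?thesis
      using trs_solution_unique(2)[OF \<open>symmetric_mat A\<close> \<mu> sol0] \<mu>(2) by simp
  qed
  have inv: "invertible ?B" using pd by (rule pos_definite_invertible)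
  note SB = matrix_inv_cancel[OF inv, folded S_def]
  have symB: "symmetric_mat ?B" using pd by (simp add: pos_definite_def)
  have symS: "u \<bullet> (S *v v) = (S *v u) \<bullet> v" for u v
    using symmetric_mat_inner[OF symB, of "S *v u" "S *v v"] by (simp add: SB)

  have near: "\<forall>\<^sub>F \<epsilon> in at 0. \<bar>lam \<epsilon> - lam 0\<bar> < \<eta> \<and> norm (x \<epsilon>) = \<Delta> \<and>
    A *v x \<epsilon> + \<epsilon> *\<^sub>R (E *v x \<epsilon>) + lam \<epsilon> *\<^sub>R x \<epsilon> = - (g + \<epsilon> *\<^sub>R e)" if "\<eta> > 0" for \<eta>
  proof -
    \<comment> \<open>Staying within \<open>lam 0\<close> of \<open>lam 0\<close> keeps the nearby
      root nonnegative, hence admissible as a multiplier.\<close>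
    have "min \<eta> (lam 0) > 0" using that \<open>0 < lam 0\<close> by simp
    from perturbed_multiplier_exists[OF \<open>symmetric_mat A\<close> \<open>symmetric_mat E\<close> pd eq0 \<open>g \<noteq> 0\<close> this, of e]
    show ?thesis
    proof eventually_elim
      case (elim \<epsilon>)
      then obtain \<mu> z where \<mu>: "\<bar>\<mu> - lam 0\<bar> < min \<eta> (lam 0)"
        and pdz: "pos_definite (A + \<epsilon> *\<^sub>R E + \<mu> *\<^sub>R mat 1)"
        and eqz: "(A + \<epsilon> *\<^sub>R E + \<mu> *\<^sub>R mat 1) *v z = - (g + \<epsilon> *\<^sub>R e)"
        and normz: "norm z = \<Delta>"
        using norm0 by blast
      have symE: "symmetric_mat (A + \<epsilon> *\<^sub>R E)"
        using symmetric_mat_shift[OF \<open>symmetric_mat A\<close> \<open>symmetric_mat E\<close>, of \<epsilon> 0] by simp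
      have solz: "trs_solution (A + \<epsilon> *\<^sub>R E) (g + \<epsilon> *\<^sub>R e) \<Delta> \<mu> z"
        using \<mu> by (intro trs_solutionI symE eqz normz pdz) linarith
      \<comment> \<open>The constructed pair itself witnesses easy case for the perturbed problem,
        so \<open>sol\<close> becomes available for this \<epsilon>.\<close>
      then have "trs_easy_case (A + \<epsilon> *\<^sub>R E) (g + \<epsilon> *\<^sub>R e) \<Delta>"
        using pdz unfolding trs_easy_case_def by blast
      then have "trs_solution (A + \<epsilon> *\<^sub>R E) (g + \<epsilon> *\<^sub>R e) \<Delta> (lam \<epsilon>) (x \<epsilon>)" by (rule sol)
      moreover have "z \<noteq> 0" using normz \<open>0 < \<Delta>\<close> by auto
      ultimately have "x \<epsilon> = z" "lam \<epsilon> = \<mu>"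
        using trs_solution_unique[OF symE solz pdz] by blast+
      then show ?case
        using \<mu> eqz normz by (simp add: shift_matrix_vector)
    qed
  qed
  have ev: "\<forall>\<^sub>F \<epsilon> in at 0. norm (x \<epsilon>) = \<Delta> \<and>
    A *v x \<epsilon> + \<epsilon> *\<^sub>R (E *v x \<epsilon>) + lam \<epsilon> *\<^sub>R x \<epsilon> = - (g + \<epsilon> *\<^sub>R e)"
    using near[of 1] by (auto elim: eventually_mono)
  have lam_lim: "(lam \<longlongrightarrow> lam 0) (at 0)"
  proof (rule tendstoI)
    fix \<eta> :: real
    assume "\<eta> > 0"
    from near[OF this] show "\<forall>\<^sub>F \<epsilon> in at 0. dist (lam \<epsilon>) (lam 0) < \<eta>"
      by eventually_elim (simp add: dist_real_def)
  qed
  \<comment> \<open>The difference of the perturbed and unperturbed stationarity equations.\<close>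
  have Bx: "?B *v (x \<epsilon> - x 0) =
      - (\<epsilon> *\<^sub>R (E *v x \<epsilon> + e)) - (lam \<epsilon> - lam 0) *\<^sub>R x \<epsilon>"
    if "A *v x \<epsilon> + \<epsilon> *\<^sub>R (E *v x \<epsilon>) + lam \<epsilon> *\<^sub>R x \<epsilon> = - (g + \<epsilon> *\<^sub>R e)" for \<epsilon>
  proof -
    have "A *v x \<epsilon> = - (g + \<epsilon> *\<^sub>R e) - \<epsilon> *\<^sub>R (E *v x \<epsilon>) - lam \<epsilon> *\<^sub>R x \<epsilon>"
      using that by (simp add: algebra_simps)
    then show ?thesis
      by (simp only: matrix_vector_mult_diff_distrib eq0)
        (simp add: shift_matrix_vector' algebra_simps)
  qed
  have x_lim: "(x \<longlongrightarrow> x 0) (at 0)"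
  proof -
    obtain c where c: "c > 0" "\<And>v. c * (v \<bullet> v) \<le> v \<bullet> (?B *v v)"
      using pos_definite_coercive[OF pd] by metis
    obtain K where K: "K > 0" "\<And>v. norm (E *v v) \<le> norm v * K"
      using bounded_linear.pos_bounded[OF matrix_vector_mul_bounded_linear[of E]] by blast
    \<comment> \<open>The active constraint bounds \<open>x \<epsilon>\<close> by \<Delta>, so the
      right-hand side of \<open>Bx\<close> tends to 0 with \<epsilon> and
      \<open>lam \<epsilon> - lam 0\<close>.\<close>
    have "\<forall>\<^sub>F \<epsilon> in at 0. norm (x \<epsilon> - x 0) \<le> (\<bar>\<epsilon>\<bar> * (\<Delta> * K + norm e) + \<bar>lam \<epsilon> - lam 0\<bar> * \<Delta>) / c"
      using ev
    proof eventually_elim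
      case (elim \<epsilon>)
      have "c * norm (x \<epsilon> - x 0) \<le> norm (\<epsilon> *\<^sub>R (E *v x \<epsilon> + e)) + norm ((lam \<epsilon> - lam 0) *\<^sub>R x \<epsilon>)"
        using coercive_norm_bound[OF c(2), of "x \<epsilon> - x 0"] Bx[of \<epsilon>] elim
          norm_triangle_ineq4[of "- (\<epsilon> *\<^sub>R (E *v x \<epsilon> + e))" "(lam \<epsilon> - lam 0) *\<^sub>R x \<epsilon>"]
        by (simp only: norm_minus_cancel)
      also have "\<dots> \<le> \<bar>\<epsilon>\<bar> * (\<Delta> * K + norm e) + \<bar>lam \<epsilon> - lam 0\<bar> * \<Delta>"
      proof -
        have "norm (E *v x \<epsilon> + e) \<le> \<Delta> * K + norm e"
          using norm_triangle_ineq[of "E *v x \<epsilon>" e] K(2)[of "x \<epsilon>"] elim by simp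
        then show ?thesis using elim by (simp add: mult_left_mono)
      qed
      finally show ?case using c(1) by (simp add: field_simps)
    qed
    moreover have "((\<lambda>\<epsilon>. (\<bar>\<epsilon>\<bar> * (\<Delta> * K + norm e) + \<bar>lam \<epsilon> - lam 0\<bar> * \<Delta>) / c)
      \<longlongrightarrow> (\<bar>0\<bar> * (\<Delta> * K + norm e) + \<bar>lam 0 - lam 0\<bar> * \<Delta>) / c) (at 0)"
      using c(1) by (intro tendsto_intros lam_lim) simp
    then have "((\<lambda>\<epsilon>. (\<bar>\<epsilon>\<bar> * (\<Delta> * K + norm e) + \<bar>lam \<epsilon> - lam 0\<bar> * \<Delta>) / c) \<longlongrightarrow> 0) (at 0)"
      by simp
    ultimately have "((\<lambda>\<epsilon>. x \<epsilon> - x 0) \<longlongrightarrow> 0) (at 0)"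
      by (rule Lim_null_comparison)
    then show ?thesis by (simp add: LIM_zero_iff)
  qed

  let ?w = "E *v x 0 + e"
  \<comment> \<open>The difference quotient with the multiplier eliminated: evaluated at
    \<open>x \<epsilon>\<close> it mentions neither \<epsilon> nor \<open>lam \<epsilon>\<close>
    separately.\<close>
  let ?D = "\<lambda>z. - (S *v (E *v z + e)) +
    (((z + x 0) \<bullet> (S *v (E *v z + e))) / ((z + x 0) \<bullet> (S *v z))) *\<^sub>R (S *v z)"
  \<comment> \<open>This is the form of \<open>?B\<close> at \<open>S *v x 0\<close>; it keeps the
    denominator of \<open>?D\<close> nonzero near the limit.\<close>
  have pos: "x 0 \<bullet> (S *v x 0) > 0"
  proof -
    have "S *v x 0 \<noteq> 0" using SB(1)[of "x 0"] x0 by auto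
    then have "0 < (S *v x 0) \<bullet> (?B *v (S *v x 0))"
      using pd unfolding pos_definite_def by blast
    then show ?thesis by (simp add: SB inner_commute)
  qed
  have mult_lim: "((\<lambda>\<epsilon>. C *v f \<epsilon>) \<longlongrightarrow> C *v l) (at 0)"
    if "(f \<longlongrightarrow> l) (at 0)" for C :: "real ^ 'n ^ 'n" and f :: "real \<Rightarrow> real ^ 'n" and l
    using bounded_linear.tendsto[OF matrix_vector_mul_bounded_linear that] .
  have den_lim: "((\<lambda>\<epsilon>. (x \<epsilon> + x 0) \<bullet> (S *v x \<epsilon>)) \<longlongrightarrow> (x 0 + x 0) \<bullet> (S *v x 0)) (at 0)"
    by (intro tendsto_intros mult_lim x_lim)
  have den0: "(x 0 + x 0) \<bullet> (S *v x 0) > 0" using pos unfolding inner_add_left by linarith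
  have D_lim: "((\<lambda>\<epsilon>. ?D (x \<epsilon>)) \<longlongrightarrow> ?D (x 0)) (at 0)"
    using den0 by (intro tendsto_intros mult_lim x_lim) simp
  have quotient: "\<forall>\<^sub>F \<epsilon> in at 0. ?D (x \<epsilon>) = (1 / \<epsilon>) *\<^sub>R (x \<epsilon> - x 0)"
    using ev order_tendstoD(1)[OF den_lim den0] eventually_neq_at_within[of 0 0 UNIV]
  proof eventually_elim
    case (elim \<epsilon>)
    let ?p = "x \<epsilon> + x 0"
    let ?q = "E *v x \<epsilon> + e"
    have h: "x \<epsilon> - x 0 = - (\<epsilon> *\<^sub>R (S *v ?q)) - (lam \<epsilon> - lam 0) *\<^sub>R (S *v x \<epsilon>)"
    proof -
      have "x \<epsilon> - x 0 = S *v (- (\<epsilon> *\<^sub>R ?q) - (lam \<epsilon> - lam 0) *\<^sub>R x \<epsilon>)"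
        using SB(2)[of "x \<epsilon> - x 0"] Bx elim by metis
      also have "\<dots> = S *v ((- \<epsilon>) *\<^sub>R ?q - (lam \<epsilon> - lam 0) *\<^sub>R x \<epsilon>)" by simp
      also have "\<dots> = (- \<epsilon>) *\<^sub>R (S *v ?q) - (lam \<epsilon> - lam 0) *\<^sub>R (S *v x \<epsilon>)"
        by (simp only: matrix_vector_mult_diff_distrib matrix_vector_mult_scaleR)
      finally show ?thesis by simp
    qed
    \<comment> \<open>Equal norms make \<open>?p\<close> orthogonal to the increment; inserting
      \<open>h\<close> leaves one linear equation for
      \<open>(lam \<epsilon> - lam 0) / \<epsilon>\<close>.\<close>
    have "?p \<bullet> (x \<epsilon> - x 0) = x \<epsilon> \<bullet> x \<epsilon> - x 0 \<bullet> x 0"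
      by (simp add: inner_add inner_diff inner_commute)
    also have "\<dots> = 0" using elim norm0 by (simp add: dot_square_norm)
    finally have "- \<epsilon> * (?p \<bullet> (S *v ?q)) - (lam \<epsilon> - lam 0) * (?p \<bullet> (S *v x \<epsilon>)) = 0"
      unfolding h by (simp add: inner_diff_right)
    then have "(?p \<bullet> (S *v ?q)) / (?p \<bullet> (S *v x \<epsilon>)) = - ((lam \<epsilon> - lam 0) / \<epsilon>)"
      using elim(2,3) by (simp add: field_simps)
    then have "?D (x \<epsilon>) = - (S *v ?q) - ((lam \<epsilon> - lam 0) / \<epsilon>) *\<^sub>R (S *v x \<epsilon>)"
      by (simp only: scaleR_minus_left add_uminus_conv_diff)
    also have "\<dots> = (1 / \<epsilon>) *\<^sub>R (x \<epsilon> - x 0)"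
      unfolding h using elim(3) by (simp add: scaleR_diff_right)
    finally show ?case .
  qed
  have "((\<lambda>\<epsilon>. (1 / \<epsilon>) *\<^sub>R (x \<epsilon> - x 0)) \<longlongrightarrow> ?D (x 0)) (at 0)"
    using Lim_transform_eventually[OF D_lim quotient] .
  then have "(x has_vector_derivative ?D (x 0)) (at 0)"
    by (intro has_vector_derivative_difference_quotientI) simp
  \<comment> \<open>At \<open>x 0\<close> the factor 2 from \<open>x 0 + x 0\<close> cancels. The
    factor \<open>k\<^sup>2\<close> cancels between \<open>outer y2 y2\<close> and
    \<open>y1 \<bullet> y2\<close>, so the result does not depend on the scaling of the
    eigenvector.\<close>
  also have "?D (x 0) = (- S + (1 / (y1 \<bullet> y2)) *\<^sub>R outer y2 y2) *v ?w"
  proof -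
    obtain k where k: "k \<noteq> 0" "y1 = k *\<^sub>R x 0" "y2 = k *\<^sub>R (S *v x 0)"
      using trs_matrix_eigenvector[OF assms(8) inv eq0] unfolding S_def .
    have "(1 / (y1 \<bullet> y2)) *\<^sub>R (outer y2 y2 *v ?w) = ((x 0 \<bullet> (S *v ?w)) / (x 0 \<bullet> (S *v x 0))) *\<^sub>R (S *v x 0)"
      using k(1) pos by (simp add: k(2,3) outer_mult_vec symS[of _ ?w])
    moreover have "((x 0 + x 0) \<bullet> (S *v ?w)) / ((x 0 + x 0) \<bullet> (S *v x 0))
        = (x 0 \<bullet> (S *v ?w)) / (x 0 \<bullet> (S *v x 0))"
    proof -
      have "(x 0 + x 0) \<bullet> v = 2 * (x 0 \<bullet> v)" for v
        by (simp only: inner_add_left mult_2)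
      then show ?thesis by (simp only: mult_divide_mult_cancel_left_if) simp
    qed
    moreover have "- S *v ?w = - (S *v ?w)"
      by (simp add: vec_eq_iff matrix_vector_mult_def sum_negf)
    ultimately show ?thesis
      by (simp only: matrix_vector_mult_add_rdistrib scaleR_matrix_vector)
  qed
  finally have deriv: "(x has_vector_derivative
    (- S + (1 / (y1 \<bullet> y2)) *\<^sub>R outer y2 y2) *v ?w) (at 0)" .
  \<comment> \<open>The radius governs only the norm equality; the limit and the derivative are
    statements at 0, the same for every \<epsilon>.\<close>
  obtain \<rho> where "\<rho> > 0" "\<And>\<epsilon>. \<epsilon> \<noteq> 0 \<Longrightarrow> \<bar>\<epsilon>\<bar> < \<rho> \<Longrightarrow> norm (x \<epsilon>) = \<Delta>"
    using ev unfolding eventually_at by (auto simp: dist_real_def)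
  then show ?thesis
    using norm0 x_lim deriv unfolding S_def by (intro exI[of _ \<rho>]) auto
qed

end
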